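(* Consider the integrator $\dot x=u$, $x,u\in\mathbb{R}^n$, with a convex control Lyapunov function $V$ (with class $\mathcal{K}$ function $\gamma$), a control barrier function $h$ (with locally Lipschitz extended class $\mathcal{K}_\infty$ function $\alpha$), and $p>0$. Let $u=k(x)$ be the feedback defined by the quadratic program $$\begin{bmatrix}k(x)^{\mathsf T} & \delta(x)\end{bmatrix}^{\mathsf T}=\operatorname*{argmin}_{(u,w)\in\mathbb{R}^{n+1}}\ \|u\|^2+p w^2\quad\text{s.t.}\quad \nabla V(x)^{\mathsf T}u\le-\gamma(V(x))+w,\quad \nabla h(x)^{\mathsf T}u\ge-\alpha(h(x)).$$ Let $x^\star\in\mathcal{E}_{\partial\mathcal{C}}$ be a boundary equilibrium point of the closed-loop system $\dot x=k(x)$, and let $c\in\mathbb{R}_{\ge0}$ be the constant satisfying $\nabla V(x^\star)=c\,\nabla h(x^\star)$. If $$H_V(x^\star)-c\,H_h(x^\star)>0$$ (positive definite), where $H_V$ and $H_h$ are the Hessian matrices of $V$ and $h$, then $x^\star$ is an asymptotically stable equilibrium of $\dot x=k(x)$.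
   Context: $\nabla$ is the gradient with respect to $x$; $v\parallel w$ means that the vectors $v,w$ are linearly dependent. Control Lyapunov function (CLF) for $\dot x=u$: a positive definite function $V:\mathbb{R}^n\to\mathbb{R}$ with $\inf_{u\in\mathbb{R}^n}\nabla V(x)^{\mathsf T}u\le-\gamma(V(x))$ for a class $\mathcal{K}$ function $\gamma:\mathbb{R}_{\ge0}\to\mathbb{R}_{\ge0}$. Control barrier function (CBF) for $\dot x=u$: a continuously differentiable $h:\mathcal{D}\subset\mathbb{R}^n\to\mathbb{R}$, with $\mathcal{C}=\{x\in\mathcal{D}:h(x)\ge0\}$ and $\partial\mathcal{C}=\{x\in\mathcal{D}:h(x)=0\}$, for which there is a locally Lipschitz extended class $\mathcal{K}_\infty$ function $\alpha$ (that is, $\alpha:\mathbb{R}\to\mathbb{R}$ strictly increasing with $\alpha(0)=0$) such that $\sup_{u\in\mathbb{R}^n}\nabla h(x)^{\mathsf T}u\ge-\alpha(h(x))$ for all $x\in\mathcal{D}$. $V$ and $h$ are assumed smooth enough for their Hessians to exist. Standing convention: $k$ is such that the closed-loop vector field is locally Lipschitz. The set of boundary equilibria for the integrator is $$\mathcal{E}_{\partial\mathcal{C}}=\{x\in\Omega^{clf}_{cbf}\cap\partial\mathcal{C}\ :\ \nabla V(x)\parallel\nabla h(x)\},$$ where $\Omega^{clf}_{cbf}$ is the set of states where both constraints of the quadratic program are active: $$\Omega^{clf}_{cbf}=\Big\{x\in\mathbb{R}^n: \nabla V^{\mathsf T}\nabla h\,\frac{\alpha(h)}{\gamma(V)}\le\|\nabla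 h\|^2,\ \ \nabla V^{\mathsf T}\nabla h\ge\frac{\alpha(h)}{\gamma(V)}(\|\nabla V\|^2+p^{-1})\Big\}$$ (all functions evaluated at $x$). *)

theory Defs
  imports "HOL-Analysis.Analysis"
begin

section \<open>Gradient and Hessian\<close>

definition gradient :: "(real^'n \<Rightarrow> real) \<Rightarrow> real^'n \<Rightarrow> real^'n" where
  "gradient f x = (\<chi> i. frechet_derivative f (at x) (axis i 1))"

definition hessian :: "(real^'n \<Rightarrow> real) \<Rightarrow> real^'n \<Rightarrow> real^'n^'n" where
  "hessian f x = jacobian (gradient f) (at x)"

definition twice_differentiable_on :: "(real^'n \<Rightarrow> real) \<Rightarrow> (real^'n) set \<Rightarrow> bool" where
  "twice_differentiable_on f S \<longleftrightarrow>
     (\<forall>x\<in>S. f differentiable (at x) \<and> gradient f differentiable (at x))"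

text \<open>Symmetry is not part of the definition; it is automatic for the Hessian matrices to which
  the notion is applied.\<close>

definition pos_def_matrix :: "real^'n^'n \<Rightarrow> bool" where
  "pos_def_matrix M \<longleftrightarrow> (\<forall>v. v \<noteq> 0 \<longrightarrow> v \<bullet> (M *v v) > 0)"

text \<open>Linear dependence of the family \<open>v, w\<close>. This differs from \<^const>\<open>dependent\<close> applied to
  the set \<open>{v, w}\<close>, which is a singleton for \<open>v = w\<close>.\<close>

definition parallel :: "real^'n \<Rightarrow> real^'n \<Rightarrow> bool" where
  "parallel v w \<longleftrightarrow> (\<exists>a b :: real. (a \<noteq> 0 \<or> b \<noteq> 0) \<and> a *\<^sub>R v + b *\<^sub>R w = 0)"

text \<open>\<^const>\<open>local_lipschitz\<close> is about functions with a time argument; here time is a dummy.\<close>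

abbreviation locally_lipschitz_on ::
    "('a::metric_space \<Rightarrow> 'b::metric_space) \<Rightarrow> 'a set \<Rightarrow> bool" where
  "locally_lipschitz_on f S \<equiv> local_lipschitz (UNIV :: real set) S (\<lambda>_. f)"

section \<open>Control Lyapunov and control barrier functions for the integrator\<close>

text \<open>Class \<open>K\<close> functions live on the nonnegative reals; values at negative arguments are
  irrelevant.\<close>

definition class_K :: "(real \<Rightarrow> real) \<Rightarrow> bool" where
  "class_K \<gamma> \<longleftrightarrow> continuous_on {0..} \<gamma> \<and> strict_mono_on {0..} \<gamma> \<and> \<gamma> 0 = 0"

definition extended_class_K_inf :: "(real \<Rightarrow> real) \<Rightarrow> bool" where
  "extended_class_K_inf \<alpha> \<longleftrightarrow> strict_mono \<alpha> \<and> \<alpha> 0 = 0"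

definition positive_definite_fun :: "(real^'n \<Rightarrow> real) \<Rightarrow> bool" where
  "positive_definite_fun V \<longleftrightarrow> V 0 = 0 \<and> (\<forall>x. x \<noteq> 0 \<longrightarrow> V x > 0)"

text \<open>The infimum and the supremum over all inputs may be infinite, hence \<^typ>\<open>ereal\<close>.\<close>

definition control_lyapunov_function ::
    "(real^'n \<Rightarrow> real) \<Rightarrow> (real \<Rightarrow> real) \<Rightarrow> bool" where
  "control_lyapunov_function V \<gamma> \<longleftrightarrow>
     positive_definite_fun V \<and> (\<forall>x. V differentiable (at x)) \<and> class_K \<gamma> \<and>
     (\<forall>x. (INF u. ereal (gradient V x \<bullet> u)) \<le> ereal (- \<gamma> (V x)))"

definition control_barrier_function ::
    "(real^'n) set \<Rightarrow> (real^'n \<Rightarrow> real) \<Rightarrow> (real \<Rightarrow> real) \<Rightarrow> bool" where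
  "control_barrier_function D h \<alpha> \<longleftrightarrow>
     open D \<and> (\<forall>x\<in>D. h differentiable (at x)) \<and> continuous_on D (gradient h) \<and>
     extended_class_K_inf \<alpha> \<and> locally_lipschitz_on \<alpha> UNIV \<and>
     (\<forall>x\<in>D. (SUP u. ereal (gradient h x \<bullet> u)) \<ge> ereal (- \<alpha> (h x)))"

text \<open>For \<open>p > 0\<close> and \<open>x \<in> D\<close> the program is feasible (by the barrier condition) and strictly
  convex, so the minimiser exists and is unique.\<close>

definition clf_cbf_qp ::
    "(real^'n \<Rightarrow> real) \<Rightarrow> (real \<Rightarrow> real) \<Rightarrow> (real^'n \<Rightarrow> real) \<Rightarrow> (real \<Rightarrow> real) \<Rightarrow> real \<Rightarrow>
     real^'n \<Rightarrow> (real^'n) \<times> real" where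
  "clf_cbf_qp V \<gamma> h \<alpha> p x =
     arg_min (\<lambda>(u, w). (norm u)\<^sup>2 + p * w\<^sup>2)
       (\<lambda>(u, w). gradient V x \<bullet> u \<le> - \<gamma> (V x) + w \<and> gradient h x \<bullet> u \<ge> - \<alpha> (h x))"

section \<open>Boundary equilibria\<close>

text \<open>The condition \<open>\<gamma> (V x) \<noteq> 0\<close> makes the quotient \<open>\<alpha> (h x) / \<gamma> (V x)\<close> meaningful; for a control
  Lyapunov function it excludes exactly the origin.\<close>

definition both_active ::
    "(real^'n) set \<Rightarrow> (real^'n \<Rightarrow> real) \<Rightarrow> (real \<Rightarrow> real) \<Rightarrow> (real^'n \<Rightarrow> real) \<Rightarrow> (real \<Rightarrow> real) \<Rightarrow>
     real \<Rightarrow> (real^'n) set" where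
  "both_active D V \<gamma> h \<alpha> p =
     {x \<in> D. \<gamma> (V x) \<noteq> 0 \<and>
        (gradient V x \<bullet> gradient h x) * (\<alpha> (h x) / \<gamma> (V x)) \<le> (norm (gradient h x))\<^sup>2 \<and>
        gradient V x \<bullet> gradient h x
          \<ge> \<alpha> (h x) / \<gamma> (V x) * ((norm (gradient V x))\<^sup>2 + inverse p)}"

definition boundary_equilibria ::
    "(real^'n) set \<Rightarrow> (real^'n \<Rightarrow> real) \<Rightarrow> (real \<Rightarrow> real) \<Rightarrow> (real^'n \<Rightarrow> real) \<Rightarrow> (real \<Rightarrow> real) \<Rightarrow>
     real \<Rightarrow> (real^'n) set" where
  "boundary_equilibria D V \<gamma> h \<alpha> p =
     {x \<in> both_active D V \<gamma> h \<alpha> p \<inter> {x \<in> D. h x = 0}. parallel (gradient V x) (gradient h x)}"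

section \<open>Asymptotic stability\<close>

definition forward_solution ::
    "('a::real_normed_vector) set \<Rightarrow> ('a \<Rightarrow> 'a) \<Rightarrow> 'a \<Rightarrow> (real \<Rightarrow> 'a) \<Rightarrow> bool" where
  "forward_solution D f x0 \<phi> \<longleftrightarrow>
     \<phi> 0 = x0 \<and>
     (\<forall>t\<ge>0. \<phi> t \<in> D \<and> (\<phi> has_vector_derivative f (\<phi> t)) (at t within {0..}))"

text \<open>Existence of solutions for all nonnegative times is part of stability, so that the
  estimates on solutions are not vacuous.\<close>

definition stable_equilibrium ::
    "('a::real_normed_vector) set \<Rightarrow> ('a \<Rightarrow> 'a) \<Rightarrow> 'a \<Rightarrow> bool" where
  "stable_equilibrium D f xs \<longleftrightarrow>
     xs \<in> D \<and> f xs = 0 \<and>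
     (\<forall>\<epsilon>>0. \<exists>d>0. \<forall>x0. dist x0 xs < d \<longrightarrow>
        (\<exists>\<phi>. forward_solution D f x0 \<phi>) \<and>
        (\<forall>\<phi>. forward_solution D f x0 \<phi> \<longrightarrow> (\<forall>t\<ge>0. dist (\<phi> t) xs < \<epsilon>)))"

definition asymptotically_stable_equilibrium ::
    "('a::real_normed_vector) set \<Rightarrow> ('a \<Rightarrow> 'a) \<Rightarrow> 'a \<Rightarrow> bool" where
  "asymptotically_stable_equilibrium D f xs \<longleftrightarrow>
     stable_equilibrium D f xs \<and>
     (\<exists>d>0. \<forall>x0 \<phi>. dist x0 xs < d \<longrightarrow> forward_solution D f x0 \<phi> \<longrightarrow> (\<phi> \<longlongrightarrow> xs) at_top)"

end

(*
  Near xs both multipliers of the quadratic program are positive, because at xs they equal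
  p * gamma (V xs) and c times this number. Hence both constraints are active near xs:
  k = l2 * grad h - l1 * grad V and (grad h) . k = - alpha h, with l2 / l1 close to c. The function
  W = V - c * h has a critical point at xs with positive definite Hessian, and along solutions
  W' = - |k|^2 / l1 - (l2 / l1 - c) * alpha h. The last term has no sign, but it is dominated by the
  decay of |h|, so U = W - W xs + 2 * |h| is a strict Lyapunov function: it decreases at a rate of at
  least |k|^2 / Lambda + |alpha h|, and this vanishes only at xs since xs is an isolated critical
  point of V on the boundary h = 0. Here Lambda = 2 * p * gamma (V xs) bounds l1 near xs.
*)

theory Submission
  imports Defs
begin

section \<open>Multipliers of the quadratic program\<close>

text \<open>This is sufficiency of the Karush-Kuhn-Tucker conditions. Stationarity in the slack
  forces the multiplier of the first constraint to be \<open>p * w\<close>, and \<open>\<mu>\<close>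
  belongs to the second (both up to the factor 2). Strict convexity makes the minimiser unique,
  which pins down the choice made by \<open>arg_min\<close>.\<close>

lemma qp_minimiser_of_multipliers:
  fixes a b u :: "real^'n"
  assumes "p > 0" "0 \<le> p * w" "0 \<le> \<mu>"
    and u: "u = \<mu> *\<^sub>R b - (p * w) *\<^sub>R a"
    and au: "a \<bullet> u = - g + w" and bu: "b \<bullet> u = - e"
  shows "arg_min (\<lambda>(u, w). (norm u)\<^sup>2 + p * w\<^sup>2) (\<lambda>(u, w). a \<bullet> u \<le> - g + w \<and> b \<bullet> u \<ge> - e) = (u, w)"
proof -
  \<comment> \<open>In the exact expansion of the objective about \<open>(u, w)\<close>, the linear
    terms are twice the sum of each multiplier times the slack of its constraint, hence nonnegative.
    The squares that remain give minimality and uniqueness alike.\<close>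
  have gap: "(norm u)\<^sup>2 + p * w\<^sup>2 + (norm (u' - u))\<^sup>2 + p * (w' - w)\<^sup>2 \<le> (norm u')\<^sup>2 + p * w'\<^sup>2"
    if "a \<bullet> u' \<le> - g + w'" "b \<bullet> u' \<ge> - e" for u' w'
  proof -
    have "0 \<le> \<mu> * (b \<bullet> u' + e)" "0 \<le> (p * w) * (- g + w' - a \<bullet> u')"
      using assms that by auto
    moreover have "u \<bullet> u' = \<mu> * (b \<bullet> u') - (p * w) * (a \<bullet> u')"
      "u \<bullet> u = \<mu> * (- e) - (p * w) * (- g + w)"
      unfolding au [symmetric] bu [symmetric] by (simp_all add: u inner_diff_left)
    moreover have "(norm u')\<^sup>2 = (norm u)\<^sup>2 + (norm (u' - u))\<^sup>2 + 2 * (u \<bullet> u' - u \<bullet> u)"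
      by (simp add: power2_norm_eq_inner inner_diff_left inner_diff_right inner_commute)
    ultimately show ?thesis
      by (simp add: power2_eq_square algebra_simps)
  qed
  show ?thesis
    unfolding arg_min_def
  proof (rule some_equality)
    show "is_arg_min (\<lambda>(u, w). (norm u)\<^sup>2 + p * w\<^sup>2) (\<lambda>(u, w). a \<bullet> u \<le> - g + w \<and> b \<bullet> u \<ge> - e) (u, w)"
    proof -
      have "(norm u)\<^sup>2 + p * w\<^sup>2 \<le> (norm u')\<^sup>2 + p * w'\<^sup>2"
        if "a \<bullet> u' \<le> - g + w'" "b \<bullet> u' \<ge> - e" for u' w'
      proof -
        have "0 \<le> (norm (u' - u))\<^sup>2" "0 \<le> p * (w' - w)\<^sup>2"
          using \<open>p > 0\<close> by simp_all
        then show ?thesis using gap [OF that] by linarith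
      qed
      then show ?thesis using au bu by (auto simp: is_arg_min_def not_less)
    qed
  next
    fix y assume y: "is_arg_min (\<lambda>(u, w). (norm u)\<^sup>2 + p * w\<^sup>2) (\<lambda>(u, w). a \<bullet> u \<le> - g + w \<and> b \<bullet> u \<ge> - e) y"
    obtain u' w' where y': "y = (u', w')" by fastforce
    have "(norm u')\<^sup>2 + p * w'\<^sup>2 \<le> (norm u)\<^sup>2 + p * w\<^sup>2"
      using y au bu unfolding y' is_arg_min_def by (fastforce simp: not_less)
    moreover have "a \<bullet> u' \<le> - g + w'" "b \<bullet> u' \<ge> - e"
      using y unfolding y' is_arg_min_def by auto
    ultimately have "(norm (u' - u))\<^sup>2 + p * (w' - w)\<^sup>2 \<le> 0"
      using gap by fastforce
    moreover have "0 \<le> (norm (u' - u))\<^sup>2" "0 \<le> p * (w' - w)\<^sup>2"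
      using \<open>p > 0\<close> by simp_all
    ultimately have "(norm (u' - u))\<^sup>2 = 0" "p * (w' - w)\<^sup>2 = 0"
      by linarith+
    then show "y = (u, w)"
      using y' \<open>p > 0\<close> by simp
  qed
qed

text \<open>\<open>l1\<close> is Cramer's rule and \<open>l2\<close> back substitution for the
  linear system that makes both constraints tight at the input
  \<open>l2 *\<^sub>R b - l1 *\<^sub>R a\<close> with slack \<open>l1 / p\<close>. Its determinant
  is positive by Cauchy-Schwarz, the term \<open>1 / p\<close> keeping it so even when
  \<open>a\<close> and \<open>b\<close> are parallel.\<close>

lemma multiplier_equations:
  fixes a b :: "real^'n"
  assumes "p > 0" "b \<noteq> 0"
    and l1: "l1 = (g * (b \<bullet> b) - e * (a \<bullet> b)) / ((a \<bullet> a + 1 / p) * (b \<bullet> b) - (a \<bullet> b)\<^sup>2)"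
    and l2: "l2 = (l1 * (a \<bullet> b) - e) / (b \<bullet> b)"
  shows "a \<bullet> (l2 *\<^sub>R b - l1 *\<^sub>R a) = - g + l1 / p" "b \<bullet> (l2 *\<^sub>R b - l1 *\<^sub>R a) = - e"
proof -
  define \<Delta> where "\<Delta> = (a \<bullet> a + 1 / p) * (b \<bullet> b) - (a \<bullet> b)\<^sup>2"
  have B: "b \<bullet> b > 0" using assms by simp
  have "(a \<bullet> b)\<^sup>2 \<le> (a \<bullet> a) * (b \<bullet> b)" by (rule Cauchy_Schwarz_ineq)
  moreover have "1 / p * (b \<bullet> b) > 0" using B assms by simp
  ultimately have "\<Delta> > 0" unfolding \<Delta>_def by (simp add: algebra_simps)
  then have 1: "l1 * \<Delta> = g * (b \<bullet> b) - e * (a \<bullet> b)" unfolding l1 \<Delta>_def [symmetric] by simp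
  have 2: "l2 * (b \<bullet> b) = l1 * (a \<bullet> b) - e" unfolding l2 using B by simp
  show "b \<bullet> (l2 *\<^sub>R b - l1 *\<^sub>R a) = - e"
    using 2 by (simp add: inner_diff_right inner_commute)
  \<comment> \<open>Multiplied by \<open>b \<bullet> b\<close>, so that fact \<open>2\<close>
    eliminates \<open>l2\<close> and the determinant appears.\<close>
  have "(b \<bullet> b) * (l2 * (a \<bullet> b) - l1 * (a \<bullet> a)) = (a \<bullet> b) * (l2 * (b \<bullet> b)) - l1 * (a \<bullet> a) * (b \<bullet> b)"
    by (simp add: algebra_simps)
  also have "\<dots> = - (l1 * \<Delta>) + l1 / p * (b \<bullet> b) - e * (a \<bullet> b)"
    unfolding 2 \<Delta>_def by (simp add: algebra_simps power2_eq_square)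
  also have "\<dots> = (b \<bullet> b) * (- g + l1 / p)"
    unfolding 1 by (simp add: algebra_simps)
  finally show "a \<bullet> (l2 *\<^sub>R b - l1 *\<^sub>R a) = - g + l1 / p"
    using B by (simp add: inner_diff_right)
qed

text \<open>The multipliers are continuous at \<open>xs\<close>. There
  \<open>a xs = c *\<^sub>R b xs\<close> reduces the determinant to
  \<open>(b xs \<bullet> b xs) / p\<close>, so that they take the values \<open>p * g xs\<close> and
  \<open>c\<close> times this. The strict inequalities hold at these values and hence
  nearby.\<close>

lemma eventually_multipliers:
  fixes a b :: "real^'n \<Rightarrow> real^'n" and g e :: "real^'n \<Rightarrow> real"
  assumes cont: "isCont a xs" "isCont b xs" "isCont g xs" "isCont e xs"
    and "p > 0" "c > 0" "\<eta> > 0" and bs: "b xs \<noteq> 0" and as: "a xs = c *\<^sub>R b xs" and "e xs = 0" "g xs > 0"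
  shows "\<forall>\<^sub>F x in nhds xs. \<exists>l1 l2. 0 < l1 \<and> l1 < 2 * p * g xs \<and> 0 < l2 \<and> \<bar>l2 / l1 - c\<bar> < \<eta> \<and>
     a x \<bullet> (l2 *\<^sub>R b x - l1 *\<^sub>R a x) = - g x + l1 / p \<and> b x \<bullet> (l2 *\<^sub>R b x - l1 *\<^sub>R a x) = - e x"
proof -
  define l1 where "l1 x = (g x * (b x \<bullet> b x) - e x * (a x \<bullet> b x)) /
    ((a x \<bullet> a x + 1 / p) * (b x \<bullet> b x) - (a x \<bullet> b x)\<^sup>2)" for x
  define l2 where "l2 x = (l1 x * (a x \<bullet> b x) - e x) / (b x \<bullet> b x)" for x
  have lim: "(a \<longlongrightarrow> a xs) (nhds xs)" "(b \<longlongrightarrow> b xs) (nhds xs)" "(g \<longlongrightarrow> g xs) (nhds xs)" "(e \<longlongrightarrow> e xs) (nhds xs)"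
    using cont by (simp_all add: isCont_def tendsto_nhds_iff)
  have B: "b xs \<bullet> b xs > 0" using bs by simp
  have \<Delta>: "(a xs \<bullet> a xs + 1 / p) * (b xs \<bullet> b xs) - (a xs \<bullet> b xs)\<^sup>2 = (b xs \<bullet> b xs) / p"
    unfolding as by (simp add: power2_eq_square algebra_simps)
  have l1s: "l1 xs = p * g xs" unfolding l1_def \<Delta> using B assms by simp
  have l2s: "l2 xs = c * l1 xs" unfolding l2_def as using B assms by simp
  have l1: "(l1 \<longlongrightarrow> l1 xs) (nhds xs)" unfolding l1_def
    by (intro tendsto_intros lim) (use \<Delta> B \<open>p > 0\<close> in auto)
  have l2: "(l2 \<longlongrightarrow> l2 xs) (nhds xs)" unfolding l2_def
    by (intro tendsto_intros lim l1) (use B in auto)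
  have pos: "l1 xs > 0" "l2 xs > 0" using l1s l2s assms by auto
  have "((\<lambda>x. \<bar>l2 x / l1 x - c\<bar>) \<longlongrightarrow> \<bar>l2 xs / l1 xs - c\<bar>) (nhds xs)"
    by (intro tendsto_intros l1 l2) (use pos in auto)
  then have "\<forall>\<^sub>F x in nhds xs. \<bar>l2 x / l1 x - c\<bar> < \<eta>"
    by (rule order_tendstoD) (use l2s pos \<open>\<eta> > 0\<close> in simp)
  moreover have "\<forall>\<^sub>F x in nhds xs. 0 < l1 x" "\<forall>\<^sub>F x in nhds xs. 0 < l2 x"
    using order_tendstoD(1) l1 l2 pos by blast+
  moreover have "\<forall>\<^sub>F x in nhds xs. l1 x < 2 * p * g xs"
    by (rule order_tendstoD(2) [OF l1]) (use l1s assms in auto)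
  moreover have "\<forall>\<^sub>F x in nhds xs. b x \<noteq> 0"
    using lim(2) bs tendsto_imp_eventually_ne by blast
  ultimately show ?thesis
  proof eventually_elim
    case (elim x)
    show ?case
      using elim multiplier_equations [OF \<open>p > 0\<close> \<open>b x \<noteq> 0\<close> l1_def l2_def] by blast
  qed
qed

section \<open>Global solutions of Lipschitz fields\<close>

text \<open>Picard iteration on the whole half-line at once: the unknown is the solution damped by
  \<open>exp (- l * t)\<close>. In the sup norm of damped curves the integral operator contracts by
  \<open>L / l\<close>, so Banach's fixed point theorem applies without any gluing of local
  solutions.\<close>

lemma lipschitz_has_forward_solution:
  fixes f :: "'a::banach \<Rightarrow> 'a"
  assumes lip: "L-lipschitz_on UNIV f"
  obtains \<phi> where "\<phi> 0 = x0"
    "\<And>t. t \<ge> 0 \<Longrightarrow> (\<phi> has_vector_derivative f (\<phi> t)) (at t within {0..})"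
proof -
  \<comment> \<open>Chosen for a contraction factor of at most 1/2; the summand 1 keeps
    \<open>l\<close> positive when \<open>L = 0\<close>.\<close>
  define l where "l = 2 * L + 1"
  have L: "L \<ge> 0" using lip by (rule lipschitz_on_nonneg)
  have l: "l > 0" "L / l \<le> 1 / 2" using L by (auto simp: l_def field_simps)
  have fcont: "continuous_on UNIV f" using lip by (rule lipschitz_on_continuous_on)
  have fL: "norm (f x - f y) \<le> L * norm (x - y)" for x y
    using lipschitz_onD [OF lip] by (simp add: dist_norm)
  \<comment> \<open>Here \<open>g\<close> is a damped curve: \<open>R g\<close> evaluates
    \<open>f\<close> on the curve with the damping removed, and \<open>F g\<close> is the Picard
    integral, damped again.\<close>
  define R where "R g s = f (exp (l * s) *\<^sub>R apply_bcontfun g s)" for g :: "real \<Rightarrow>\<^sub>C 'a" and s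
  define F where "F g t = exp (- l * t) *\<^sub>R (x0 + integral {0..t} (R g))" for g t
  have Rcont: "continuous_on S (R g)" for g S
    unfolding R_def
    by (intro continuous_on_compose2 [OF fcont] continuous_intros) auto
  have Rint: "R g integrable_on {0..t}" for g t
    by (intro integrable_continuous_interval Rcont)
  have exp_int: "((\<lambda>s. C * exp (l * s)) has_integral C * (exp (l * t) - 1) / l) {0..t}" if "t \<ge> 0" for C t
  proof -
    have "((\<lambda>s. C * exp (l * s)) has_integral C / l * exp (l * t) - C / l * exp (l * 0)) {0..t}"
      by (rule fundamental_theorem_of_calculus)
        (use l that in \<open>auto intro!: derivative_eq_intros simp flip: has_real_derivative_iff_has_vector_derivative\<close>)
    then show ?thesis by (simp add: algebra_simps diff_divide_distrib)
  qed
  \<comment> \<open>An integrand growing at most like \<open>C * exp (l * s)\<close> has a damped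
    integral of at most \<open>C / l\<close>. This yields both the boundedness of \<open>F g\<close>
    and the contraction.\<close>
  have bound: "norm (exp (- l * t) *\<^sub>R integral {0..t} H) \<le> C / l"
    if "t \<ge> 0" "H integrable_on {0..t}" "C \<ge> 0" "\<And>s. s \<in> {0..t} \<Longrightarrow> norm (H s) \<le> C * exp (l * s)" for t C and H :: "real \<Rightarrow> 'a"
  proof -
    have "norm (integral {0..t} H) \<le> integral {0..t} (\<lambda>s. C * exp (l * s))"
      by (rule integral_norm_bound_integral) (use that exp_int in \<open>auto simp: integrable_on_def\<close>)
    also have "\<dots> = C * (exp (l * t) - 1) / l"
      using exp_int [OF \<open>t \<ge> 0\<close>] by (rule integral_unique)
    also have "\<dots> \<le> exp (l * t) * (C / l)"
      using that l by (simp add: field_simps)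
    finally have "exp (- l * t) * norm (integral {0..t} H) \<le> exp (- l * t) * (exp (l * t) * (C / l))"
      by (rule mult_left_mono) simp
    then show ?thesis by (simp add: mult.assoc [symmetric] exp_add [symmetric])
  qed
  have Fcont: "continuous_on {0..} (F g)" for g
  proof -
    have "continuous_on {0..T} (F g)" for T
      unfolding F_def by (intro continuous_intros indefinite_integral_continuous_1 Rint)
    then have "continuous (at t within {0..}) (F g)" if "t \<ge> 0" for t
    proof -
      have "at t within {0..} = at t within {0..t + 1}"
        by (rule at_within_nhd [of _ "{..<t + 1}"]) (use that in auto)
      then show ?thesis
        using \<open>continuous_on {0..t+1} (F g)\<close> that by (auto simp: continuous_on_eq_continuous_within)
    qed
    then show ?thesis by (simp add: continuous_on_eq_continuous_within)
  qed
  have Fbound: "norm (F g t) \<le> norm x0 + (norm (f 0) + L * norm g) / l" if "t \<ge> 0" for g t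
  proof -
    have "norm (R g s) \<le> (norm (f 0) + L * norm g) * exp (l * s)" if "s \<in> {0..t}" for s
    proof -
      \<comment> \<open>A Lipschitz field grows at most linearly; in the next step
        \<open>exp (l * s) \<ge> 1\<close> absorbs the constant term.\<close>
      have "norm (R g s) \<le> norm (f 0) + L * norm (exp (l * s) *\<^sub>R apply_bcontfun g s)"
        using fL [of "exp (l * s) *\<^sub>R apply_bcontfun g s" 0] norm_triangle_sub [of "R g s" "f 0"]
        by (simp add: R_def)
      also have "\<dots> \<le> norm (f 0) * exp (l * s) + L * (exp (l * s) * norm g)"
        using that l L norm_bounded [of g s]
        by (intro add_mono mult_left_mono) (auto simp: mult_le_cancel_left1)
      finally show ?thesis by (simp add: algebra_simps)
    qed
    then have "norm (exp (- l * t) *\<^sub>R integral {0..t} (R g)) \<le> (norm (f 0) + L * norm g) / l"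
      using that L by (intro bound Rint) auto
    moreover have "norm (exp (- l * t) *\<^sub>R x0) \<le> norm x0"
      using that l by (simp add: mult_left_le_one_le)
    ultimately show ?thesis
      unfolding F_def scaleR_add_right by (rule norm_triangle_mono [OF _ _, rotated])
  qed
  \<comment> \<open>Bounded continuous functions live on the whole line here, so the curve is frozen
    at its value at time 0 for negative times.\<close>
  define T where "T g = Bcontfun (\<lambda>t. F g (max 0 t))" for g
  have T: "apply_bcontfun (T g) t = F g (max 0 t)" for g t
  proof -
    have "(\<lambda>t. F g (max 0 t)) \<in> bcontfun"
    proof (rule bcontfun_normI)
      show "continuous_on UNIV (\<lambda>t. F g (max 0 t))"
        by (intro continuous_on_compose2 [OF Fcont] continuous_intros) auto
      show "norm (F g (max 0 t)) \<le> norm x0 + (norm (f 0) + L * norm g) / l" for t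
        by (intro Fbound) simp
    qed
    then show ?thesis by (simp add: T_def Bcontfun_inverse)
  qed
  have "dist (T g) (T g') \<le> 1 / 2 * dist g g'" for g g'
  proof (rule dist_bound)
    fix t :: real
    define m where "m = max 0 t"
    have "m \<ge> 0" by (simp add: m_def)
    have "norm (exp (- l * m) *\<^sub>R integral {0..m} (\<lambda>s. R g s - R g' s)) \<le> (L * dist g g') / l"
    proof (rule bound [OF \<open>m \<ge> 0\<close>])
      show "norm (R g s - R g' s) \<le> L * dist g g' * exp (l * s)" for s
      proof -
        have "norm (R g s - R g' s) \<le> L * norm (exp (l * s) *\<^sub>R (apply_bcontfun g s - apply_bcontfun g' s))"
          unfolding R_def scaleR_diff_right by (rule fL)
        also have "\<dots> \<le> L * (exp (l * s) * dist g g')"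
          using L dist_bounded [of g s g'] by (intro mult_left_mono) (auto simp: dist_norm)
        finally show ?thesis by (simp add: algebra_simps)
      qed
    qed (use L in \<open>auto intro!: integrable_diff Rint\<close>)
    also have "\<dots> \<le> 1 / 2 * dist g g'"
      using mult_right_mono [OF l(2), of "dist g g'"] by simp
    finally show "dist (apply_bcontfun (T g) t) (apply_bcontfun (T g') t) \<le> 1 / 2 * dist g g'"
      unfolding T m_def [symmetric]
      by (simp add: F_def dist_norm integral_diff Rint scaleR_diff_right [symmetric])
  qed
  then have "\<exists>!g. T g = g"
    by (intro banach_fix_type [of "1/2"]) auto
  then obtain g where g: "T g = g" by blast
  define \<phi> where "\<phi> t = x0 + integral {0..t} (R g)" for t
  \<comment> \<open>The fixed point \<open>g\<close> is \<open>\<phi>\<close> damped, so removing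
    the damping inside \<open>R\<close> leaves \<open>f\<close> along \<open>\<phi>\<close>.\<close>
  have R: "R g t = f (\<phi> t)" if "t \<ge> 0" for t
  proof -
    have "apply_bcontfun g t = F g t"
      using T [of g t] g that by simp
    then show ?thesis unfolding R_def F_def \<phi>_def by (simp add: exp_minus)
  qed
  show thesis
  proof
    show "\<phi> 0 = x0" by (simp add: \<phi>_def)
    fix t :: real assume "t \<ge> 0"
    \<comment> \<open>The fundamental theorem of calculus is applied on a compact interval that
      agrees with the half-line near \<open>t\<close>.\<close>
    have "at t within {0..} = at t within {0..t + 1}"
      by (rule at_within_nhd [of _ "{..<t + 1}"]) (use \<open>t \<ge> 0\<close> in auto)
    moreover have "((\<lambda>t. integral {0..t} (R g)) has_vector_derivative R g t) (at t within {0..t + 1})"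
      by (rule integral_has_vector_derivative [OF Rcont]) (use \<open>t \<ge> 0\<close> in auto)
    then have "(\<phi> has_vector_derivative R g t) (at t within {0..t + 1})"
      unfolding \<phi>_def by (auto intro!: derivative_eq_intros)
    ultimately show "(\<phi> has_vector_derivative f (\<phi> t)) (at t within {0..})"
      using R \<open>t \<ge> 0\<close> by simp
  qed
qed

section \<open>Lyapunov's direct method\<close>

text \<open>The times with \<open>m \<le> f\<close> form a closed set, whose infimum is the hitting
  time; the intermediate value theorem gives equality there. This serves to cut an escaping orbit at
  its first contact with a sphere.\<close>

lemma continuous_first_hit:
  fixes f :: "real \<Rightarrow> real"
  assumes "continuous_on {a..b} f" "a \<le> b" "f a < m" "m \<le> f b"
  obtains t where "a \<le> t" "t \<le> b" "f t = m" "\<And>s. a \<le> s \<Longrightarrow> s \<le> t \<Longrightarrow> f s \<le> m"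
proof -
  define S where "S = {a..b} \<inter> f -` {m..}"
  have "closed S" unfolding S_def
    using assms continuous_closed_preimage [of "{a..b}" f "{m..}"] by simp
  moreover have ne: "S \<noteq> {}" "bdd_below S" using assms by (auto simp: S_def intro: bdd_belowI [of _ a])
  ultimately have "Inf S \<in> S" by (intro closed_contains_Inf)
  define t where "t = Inf S"
  have t: "a \<le> t" "t \<le> b" "m \<le> f t" using \<open>Inf S \<in> S\<close> by (auto simp: S_def t_def)
  have less: "f s < m" if "a \<le> s" "s < t" for s
  proof (rule ccontr)
    assume "\<not> f s < m"
    then have "s \<in> S" using that t by (simp add: S_def)
    then have "t \<le> s" unfolding t_def by (rule cInf_lower) (rule ne)
    with that show False by simp
  qed
  have "continuous_on {a..t} f"
    by (rule continuous_on_subset [OF assms(1)]) (use t in auto)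
  then obtain s where s: "a \<le> s" "s \<le> t" "f s = m"
    using IVT' [of f a m t] t assms by auto
  then have "s = t" using less [of s] by linarith
  show thesis
  proof
    show "a \<le> t" "t \<le> b" "f t = m" using t s \<open>s = t\<close> by auto
    show "f s \<le> m" if "a \<le> s" "s \<le> t" for s
      using that less [of s] \<open>f t = m\<close> by (cases "s = t") auto
  qed
qed

text \<open>Lyapunov's theorem with the decrease in integrated form: \<open>z\<close> is any lower
  bound of the rate \<open>Z\<close> along a piece of a solution. No derivative of \<open>U\<close>
  is asked for, because the function to be used later contains \<open>\<bar>h x\<bar>\<close>, which
  need not be differentiable where \<open>h\<close> vanishes.\<close>

lemma asymptotically_stable_if_lyapunov:
  fixes f :: "'a::euclidean_space \<Rightarrow> 'a" and U Z :: "'a \<Rightarrow> real"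
  assumes "r > 0" and sub: "cball xs r \<subseteq> D" and "f xs = 0"
    and lip: "L-lipschitz_on (cball xs r) f"
    and U_cont: "continuous_on (cball xs r) U" and U0: "U xs = 0"
    and U_pos: "\<And>x. x \<in> cball xs r \<Longrightarrow> x \<noteq> xs \<Longrightarrow> U x > 0"
    and Z_cont: "continuous_on (cball xs r) Z" and Z_nonneg: "\<And>x. x \<in> cball xs r \<Longrightarrow> Z x \<ge> 0"
    and Z_pos: "\<And>x. x \<in> cball xs r \<Longrightarrow> x \<noteq> xs \<Longrightarrow> Z x \<noteq> 0"
    and dec: "\<And>\<phi> a b z. a \<le> b \<Longrightarrow>
      (\<And>t. t \<in> {a..b} \<Longrightarrow> \<phi> t \<in> cball xs r \<and> z \<le> Z (\<phi> t) \<and>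
          (\<phi> has_vector_derivative f (\<phi> t)) (at t within {a..b})) \<Longrightarrow>
      U (\<phi> b) \<le> U (\<phi> a) - z * (b - a)"
  shows "asymptotically_stable_equilibrium D f xs"
proof -
  \<comment> \<open>Covers both the solutions of \<open>f\<close> and those of the globally Lipschitz field obtained from \<open>f\<close>
    by projecting to the ball, which provides existence for all times.\<close>
  define orbit where "orbit \<phi> \<longleftrightarrow> continuous_on {0..} \<phi> \<and>
    (\<forall>t\<ge>0. \<phi> t \<in> cball xs r \<longrightarrow> (\<phi> has_vector_derivative f (\<phi> t)) (at t within {0..}))" for \<phi>
  have decrease: "U (\<phi> b) \<le> U (\<phi> a) - z * (b - a)"
    if "orbit \<phi>" "0 \<le> a" "a \<le> b" "\<And>t. a \<le> t \<Longrightarrow> t \<le> b \<Longrightarrow> \<phi> t \<in> cball xs r \<and> z \<le> Z (\<phi> t)" for \<phi> a b z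
  proof (rule dec [OF \<open>a \<le> b\<close>], intro conjI)
    fix t assume t: "t \<in> {a..b}"
    then show "\<phi> t \<in> cball xs r" "z \<le> Z (\<phi> t)" using that by auto
    with t that have "(\<phi> has_vector_derivative f (\<phi> t)) (at t within {0..})"
      by (auto simp: orbit_def)
    then show "(\<phi> has_vector_derivative f (\<phi> t)) (at t within {a..b})"
      by (rule has_vector_derivative_within_subset) (use that in auto)
  qed
  \<comment> \<open>\<open>U\<close> is at least some \<open>m > 0\<close> on the sphere of radius
    \<open>\<epsilon>\<close> and below \<open>m\<close> near \<open>xs\<close>. Since it does not
    increase inside the ball, an orbit starting near \<open>xs\<close> never reaches the sphere. The
    start time \<open>s\<close> is arbitrary because attractivity applies this from a late time
    on.\<close>
  have trap: "\<exists>d>0. \<forall>\<phi> s t. orbit \<phi> \<longrightarrow> 0 \<le> s \<longrightarrow> dist (\<phi> s) xs < d \<longrightarrow> s \<le> t \<longrightarrow> dist (\<phi> t) xs < \<epsilon>"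
    if \<epsilon>: "0 < \<epsilon>" "\<epsilon> \<le> r" for \<epsilon>
  proof -
    have "sphere xs \<epsilon> \<subseteq> cball xs r" using \<epsilon> by auto
    obtain m where m: "m > 0" "\<And>x. x \<in> sphere xs \<epsilon> \<Longrightarrow> m \<le> U x"
    proof -
      obtain y where y: "y \<in> sphere xs \<epsilon>" "\<And>x. x \<in> sphere xs \<epsilon> \<Longrightarrow> U y \<le> U x"
        using continuous_attains_inf [of "sphere xs \<epsilon>" U] continuous_on_subset [OF U_cont \<open>sphere xs \<epsilon> \<subseteq> _\<close>] \<epsilon>
        by auto
      have "y \<noteq> xs" using y \<epsilon> by auto
      then show thesis using that [of "U y"] y U_pos \<open>sphere xs \<epsilon> \<subseteq> _\<close> by blast
    qed
    have "\<exists>d>0. \<forall>x\<in>cball xs r. dist x xs < d \<longrightarrow> dist (U x) (U xs) < m"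
      using U_cont m(1) \<open>r > 0\<close> unfolding continuous_on_iff by simp
    then obtain d0 where d0: "d0 > 0" "\<And>x. x \<in> cball xs r \<Longrightarrow> dist x xs < d0 \<Longrightarrow> dist (U x) (U xs) < m"
      by blast
    define d where "d = min d0 \<epsilon>"
    have "dist (\<phi> t) xs < \<epsilon>" if \<phi>: "orbit \<phi>" "0 \<le> s" "dist (\<phi> s) xs < d" "s \<le> t" for \<phi> s t
    proof (rule ccontr)
      assume "\<not> dist (\<phi> t) xs < \<epsilon>"
      moreover have "continuous_on {s..t} (\<lambda>t. dist (\<phi> t) xs)"
        using \<phi> continuous_on_subset [of "{0..}" \<phi> "{s..t}"] by (intro continuous_intros) (auto simp: orbit_def)
      moreover have "dist (\<phi> s) xs < \<epsilon>" using \<phi> by (simp add: d_def)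
      ultimately obtain t1 where t1: "s \<le> t1" "dist (\<phi> t1) xs = \<epsilon>"
        "\<And>t. s \<le> t \<Longrightarrow> t \<le> t1 \<Longrightarrow> dist (\<phi> t) xs \<le> \<epsilon>"
        using continuous_first_hit [of s t "\<lambda>t. dist (\<phi> t) xs" \<epsilon>] \<open>s \<le> t\<close> by (metis not_less)
      have "\<phi> t \<in> cball xs r \<and> 0 \<le> Z (\<phi> t)" if "s \<le> t" "t \<le> t1" for t
        using t1(3) [OF that] \<epsilon> Z_nonneg [of "\<phi> t"] by (auto simp: dist_commute)
      then have "U (\<phi> t1) \<le> U (\<phi> s) - 0 * (t1 - s)"
        by (intro decrease) (use \<phi> t1 in auto)
      moreover have "m \<le> U (\<phi> t1)" using t1 by (intro m) (simp add: dist_commute)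
      moreover have "dist (U (\<phi> s)) (U xs) < m"
        using \<phi> \<epsilon> by (intro d0) (auto simp: d_def dist_commute)
      ultimately show False using U0 by (simp add: dist_real_def)
    qed
    then show ?thesis using d0 \<epsilon> by (intro exI [of _ d]) (auto simp: d_def)
  qed
  have orbit_forward: "orbit \<phi>" if "forward_solution D f x0 \<phi>" for x0 \<phi>
    using that unfolding orbit_def forward_solution_def
    by (auto simp: continuous_on_eq_continuous_within intro: has_vector_derivative_continuous)
  obtain d where d: "d > 0"
    "\<And>\<phi> s t. orbit \<phi> \<Longrightarrow> 0 \<le> s \<Longrightarrow> dist (\<phi> s) xs < d \<Longrightarrow> s \<le> t \<Longrightarrow> dist (\<phi> t) xs < r"
    using trap [of r] \<open>r > 0\<close> by blast
  \<comment> \<open>Precomposition with the projection \<open>P\<close> onto the ball makes the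
    field globally Lipschitz. The trap keeps the resulting orbit in the ball, where \<open>P\<close>
    is the identity, so that it solves the original equation.\<close>
  have existence: "\<exists>\<phi>. forward_solution D f x0 \<phi>" if x0: "dist x0 xs < d" for x0
  proof -
    define P where "P = closest_point (cball xs r)"
    have P: "P x \<in> cball xs r" for x
      unfolding P_def using \<open>r > 0\<close> by (intro closest_point_in_set) auto
    have "1-lipschitz_on UNIV P"
      unfolding P_def using \<open>r > 0\<close> by (intro lipschitz_onI) (auto intro!: closest_point_lipschitz)
    then have "(L * 1)-lipschitz_on UNIV (\<lambda>x. f (P x))"
      by (rule lipschitz_on_compose2) (rule lipschitz_on_subset [OF lip], use P in auto)
    then obtain \<phi> where \<phi>: "\<phi> 0 = x0"
      "\<And>t. t \<ge> 0 \<Longrightarrow> (\<phi> has_vector_derivative f (P (\<phi> t))) (at t within {0..})"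
      using lipschitz_has_forward_solution by blast
    have P_id: "P x = x" if "x \<in> cball xs r" for x
      unfolding P_def by (rule closest_point_self [OF that])
    have "orbit \<phi>"
      unfolding orbit_def
    proof (intro conjI allI impI)
      show "continuous_on {0..} \<phi>"
        using \<phi>(2) by (auto simp: continuous_on_eq_continuous_within intro: has_vector_derivative_continuous)
      show "(\<phi> has_vector_derivative f (\<phi> t)) (at t within {0..})" if "t \<ge> 0" "\<phi> t \<in> cball xs r" for t
        using \<phi>(2) [OF that(1)] P_id [OF that(2)] by simp
    qed
    then have "\<phi> t \<in> cball xs r" if "t \<ge> 0" for t
      using d(2) [of \<phi> 0 t] that x0 \<phi>(1) by (simp add: dist_commute less_imp_le)
    then have "forward_solution D f x0 \<phi>"
      unfolding forward_solution_def using \<phi> P_id sub by (metis subsetD)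
    then show ?thesis by blast
  qed
  have stable: "stable_equilibrium D f xs"
    unfolding stable_equilibrium_def
  proof (intro conjI allI impI)
    show "xs \<in> D" using sub \<open>r > 0\<close> by auto
    show "f xs = 0" by fact
    fix \<epsilon> :: real assume "\<epsilon> > 0"
    then obtain d' where d': "d' > 0"
      "\<And>\<phi> s t. orbit \<phi> \<Longrightarrow> 0 \<le> s \<Longrightarrow> dist (\<phi> s) xs < d' \<Longrightarrow> s \<le> t \<Longrightarrow> dist (\<phi> t) xs < min \<epsilon> r"
      using trap [of "min \<epsilon> r"] \<open>r > 0\<close> by auto
    show "\<exists>d>0. \<forall>x0. dist x0 xs < d \<longrightarrow> (\<exists>\<phi>. forward_solution D f x0 \<phi>) \<and>
        (\<forall>\<phi>. forward_solution D f x0 \<phi> \<longrightarrow> (\<forall>t\<ge>0. dist (\<phi> t) xs < \<epsilon>))"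
    proof (intro exI [of _ "min d d'"] conjI allI impI)
      fix x0 \<phi> and t :: real
      assume "dist x0 xs < min d d'" "forward_solution D f x0 \<phi>" "t \<ge> 0"
      then show "dist (\<phi> t) xs < \<epsilon>"
        using d'(2) [of \<phi> 0 t] orbit_forward by (auto simp: forward_solution_def)
    qed (use d d' existence in auto)
  qed
  have "(\<phi> \<longlongrightarrow> xs) at_top" if x0: "dist x0 xs < d" and sol: "forward_solution D f x0 \<phi>" for x0 \<phi>
  proof (rule tendstoI)
    fix e :: real assume "e > 0"
    have orb: "orbit \<phi>" using sol by (rule orbit_forward)
    have ball: "\<phi> t \<in> cball xs r" if "t \<ge> 0" for t
      using d(2) [OF orb, of 0 t] x0 sol that by (simp add: forward_solution_def dist_commute less_imp_le)
    obtain d' where d': "d' > 0" "\<And>s t. 0 \<le> s \<Longrightarrow> dist (\<phi> s) xs < d' \<Longrightarrow> s \<le> t \<Longrightarrow> dist (\<phi> t) xs < min e r"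
      using trap [of "min e r"] \<open>r > 0\<close> \<open>e > 0\<close> orb by simp blast
    \<comment> \<open>By the trap, one visit to the \<open>d'\<close>-ball suffices. Without a visit
      the orbit would stay in the compact shell \<open>A\<close>, on which \<open>Z\<close> has a
      positive minimum.\<close>
    have "\<exists>s\<ge>0. dist (\<phi> s) xs < d'"
    proof (rule ccontr)
      assume "\<not> (\<exists>s\<ge>0. dist (\<phi> s) xs < d')"
      then have far: "d' \<le> dist (\<phi> s) xs" if "s \<ge> 0" for s using that by force
      define A where "A = cball xs r - ball xs d'"
      have A: "compact A" "A \<subseteq> cball xs r" "xs \<notin> A"
        using d' by (auto simp: A_def intro: compact_diff)
      have in_A: "\<phi> s \<in> A" if "s \<ge> 0" for s
        using far [OF that] ball [OF that] by (auto simp: A_def dist_commute)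
      obtain y where y: "y \<in> A" "\<And>x. x \<in> A \<Longrightarrow> Z y \<le> Z x"
        using continuous_attains_inf [OF A(1) _ continuous_on_subset [OF Z_cont A(2)]] in_A [of 0] by auto
      have "Z y > 0" using Z_pos [of y] Z_nonneg [of y] y(1) A by force
      \<comment> \<open>By this time, a decrease at rate \<open>Z y\<close> would have brought
        \<open>U\<close> down to -1 or less.\<close>
      define b where "b = (U (\<phi> 0) + 1) / Z y"
      have "U (\<phi> s) \<ge> 0" if "s \<ge> 0" for s
        using U_pos [of "\<phi> s"] in_A [OF that] A by force
      then have "b > 0" "U (\<phi> b) \<ge> 0"
        using \<open>Z y > 0\<close> by (auto simp: b_def add_nonneg_pos)
      moreover have "U (\<phi> b) \<le> U (\<phi> 0) - Z y * (b - 0)"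
        by (rule decrease [OF orb]) (use \<open>b > 0\<close> ball in_A y in auto)
      ultimately show False using \<open>Z y > 0\<close> by (simp add: b_def)
    qed
    then obtain s where "s \<ge> 0" "dist (\<phi> s) xs < d'" by blast
    then show "\<forall>\<^sub>F t in at_top. dist (\<phi> t) xs < e"
      using d'(2) by (auto simp: eventually_at_top_linorder)
  qed
  then show ?thesis
    unfolding asymptotically_stable_equilibrium_def using stable d(1) by blast
qed

section \<open>Gradients, Hessians and isolated critical points\<close>

lemma gradient_has_derivative:
  assumes "f differentiable (at x)"
  shows "(f has_derivative (\<lambda>v. gradient f x \<bullet> v)) (at x)"
proof -
  have D: "(f has_derivative frechet_derivative f (at x)) (at x)"
    using assms by (simp add: frechet_derivative_works)
  then have lin: "linear (frechet_derivative f (at x))" by (rule has_derivative_linear)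
  have "frechet_derivative f (at x) = (\<lambda>v. gradient f x \<bullet> v)"
  proof
    fix v
    have "frechet_derivative f (at x) v = frechet_derivative f (at x) (\<Sum>i\<in>UNIV. v $ i *\<^sub>R axis i 1)"
      using basis_expansion [of v] by (simp add: scalar_mult_eq_scaleR)
    also have "\<dots> = gradient f x \<bullet> v"
      by (simp add: linear_sum [OF lin] linear_scale [OF lin] gradient_def inner_vec_def mult.commute)
    finally show "frechet_derivative f (at x) v = gradient f x \<bullet> v" .
  qed
  with D show ?thesis by simp
qed

lemma hessian_has_derivative:
  assumes "gradient f differentiable (at x)"
  shows "(gradient f has_derivative (\<lambda>v. hessian f x *v v)) (at x)"
  using assms unfolding hessian_def by (simp add: jacobian_works)

text \<open>The constant is the minimum of the quadratic form on the unit sphere, attained by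
  compactness; homogeneity of degree two does the rest.\<close>

lemma pos_def_matrix_bound:
  fixes M :: "real^'n^'n"
  assumes "pos_def_matrix M"
  obtains m where "m > 0" "\<And>v. m * (norm v)\<^sup>2 \<le> v \<bullet> (M *v v)"
proof -
  have "continuous_on (sphere 0 1) (\<lambda>v. v \<bullet> (M *v v))"
    by (intro continuous_intros matrix_vector_mult_linear_continuous_on)
  moreover have "sphere (0 :: real^'n) 1 \<noteq> {}" by (simp add: sphere_eq_empty)
  ultimately obtain y where y: "y \<in> sphere 0 1" "\<And>v. v \<in> sphere 0 1 \<Longrightarrow> y \<bullet> (M *v y) \<le> v \<bullet> (M *v v)"
    using continuous_attains_inf [OF compact_sphere] by blast
  show thesis
  proof
    have "y \<noteq> 0" using y(1) by auto
    then show "y \<bullet> (M *v y) > 0" using assms by (simp add: pos_def_matrix_def)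
    fix v :: "real^'n"
    show "y \<bullet> (M *v y) * (norm v)\<^sup>2 \<le> v \<bullet> (M *v v)"
    proof (cases "v = 0")
      case False
      then have "y \<bullet> (M *v y) \<le> (v /\<^sub>R norm v) \<bullet> (M *v (v /\<^sub>R norm v))" by (intro y) simp
      also have "\<dots> = v \<bullet> (M *v v) / (norm v)\<^sup>2"
        by (simp add: matrix_vector_mult_scaleR divide_inverse power2_eq_square)
      finally show ?thesis using False by (simp add: field_simps)
    qed simp
  qed
qed

text \<open>Write \<open>y = x - xs\<close>. Linearising \<open>G\<close> gives
  \<open>G x \<bullet> y\<close> at least of order \<open>(norm y)\<^sup>2\<close>. If moreover
  \<open>h x = 0\<close> and \<open>G x = t *\<^sub>R b x\<close>, then \<open>t\<close> is of order
  \<open>norm y\<close> while \<open>b x \<bullet> y\<close> is of smaller order, as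
  \<open>y\<close> is almost tangent to the level set of \<open>h\<close>. Their product would then
  be too small.\<close>

lemma eventually_isolated_critical_point:
  fixes G b :: "real^'n \<Rightarrow> real^'n" and h :: "real^'n \<Rightarrow> real"
  assumes G: "(G has_derivative (\<lambda>v. M *v v)) (at xs)" and "G xs = 0" and "pos_def_matrix M"
    and h: "(h has_derivative (\<lambda>v. b xs \<bullet> v)) (at xs)" and "h xs = 0" and "isCont b xs" and "b xs \<noteq> 0"
  shows "\<forall>\<^sub>F x in nhds xs. x \<noteq> xs \<longrightarrow> G x \<bullet> (x - xs) > 0 \<and> (h x = 0 \<longrightarrow> (\<forall>t. G x \<noteq> t *\<^sub>R b x))"
proof -
  obtain m where m: "m > 0" "\<And>v. m * (norm v)\<^sup>2 \<le> v \<bullet> (M *v v)"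
    using pos_def_matrix_bound assms(3) by blast
  obtain B where B: "B > 0" "\<And>v. norm (M *v v) \<le> norm v * B"
    using bounded_linear.pos_bounded [OF matrix_vector_mul_bounded_linear] by blast
  \<comment> \<open>\<open>C * norm y\<close> will bound \<open>norm (G x)\<close> from above and
    \<open>\<beta>\<close> will bound \<open>norm (b x)\<close> from below. \<open>e\<close> is
    calibrated so that \<open>2 * C * e / \<beta> = m / 4\<close>, which lies below the
    \<open>m / 2\<close> of the quadratic lower bound.\<close>
  define C where "C = B + m / 2"
  have "C > 0" using B m by (simp add: C_def)
  define \<beta> where "\<beta> = norm (b xs) / 2"
  have "\<beta> > 0" using assms by (simp add: \<beta>_def)
  define e where "e = m * \<beta> / (8 * C)"
  have "e > 0" using m \<open>C > 0\<close> \<open>\<beta> > 0\<close> by (simp add: e_def)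
  have "\<forall>\<^sub>F x in nhds xs. norm (G x - M *v (x - xs)) \<le> m / 2 * norm (x - xs)"
  proof -
    obtain d where "d > 0" "\<And>y. norm (y - xs) < d \<Longrightarrow> norm (G y - G xs - M *v (y - xs)) \<le> m / 2 * norm (y - xs)"
      using G m(1) unfolding has_derivative_at_alt by (meson half_gt_zero)
    then show ?thesis using \<open>G xs = 0\<close> by (auto simp: eventually_nhds_metric dist_norm)
  qed
  moreover have "\<forall>\<^sub>F x in nhds xs. \<bar>h x - b xs \<bullet> (x - xs)\<bar> \<le> e * norm (x - xs)"
  proof -
    obtain d where "d > 0" "\<And>y. norm (y - xs) < d \<Longrightarrow> norm (h y - h xs - b xs \<bullet> (y - xs)) \<le> e * norm (y - xs)"
      using h \<open>e > 0\<close> unfolding has_derivative_at_alt by meson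
    then show ?thesis using \<open>h xs = 0\<close> by (auto simp: eventually_nhds_metric dist_norm)
  qed
  moreover have "\<forall>\<^sub>F x in nhds xs. dist (b x) (b xs) < min e \<beta>"
    using \<open>isCont b xs\<close> \<open>e > 0\<close> \<open>\<beta> > 0\<close>
    by (intro tendstoD) (simp_all add: isCont_def tendsto_nhds_iff)
  ultimately show ?thesis
  proof eventually_elim
    case (elim x)
    define y where "y = x - xs"
    have Gy: "m / 2 * (norm y)\<^sup>2 \<le> G x \<bullet> y"
    proof -
      have "\<bar>(G x - M *v y) \<bullet> y\<bar> \<le> (m / 2 * norm y) * norm y"
        using elim(1) unfolding y_def [symmetric]
        by (intro order_trans [OF Cauchy_Schwarz_ineq2] mult_right_mono) auto
      moreover have "y \<bullet> (M *v y) = G x \<bullet> y - (G x - M *v y) \<bullet> y"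
        by (simp add: inner_diff_left inner_commute [of y])
      moreover have "(m / 2 * norm y) * norm y = m * (norm y)\<^sup>2 - m / 2 * (norm y)\<^sup>2"
        by (simp add: power2_eq_square)
      ultimately show ?thesis using m(2) [of y] by linarith
    qed
    have False if "x \<noteq> xs" "h x = 0" "G x = t *\<^sub>R b x" for t
    proof -
      have "y \<noteq> 0" using that by (simp add: y_def)
      have "norm (G x) \<le> norm (M *v y) + norm (G x - M *v y)"
        by (metis add.commute norm_triangle_sub)
      also have "\<dots> \<le> C * norm y"
        using elim(1) B(2) [of y] by (simp add: C_def y_def algebra_simps)
      finally have "\<bar>t\<bar> * norm (b x) \<le> C * norm y" using that by simp
      moreover have "\<beta> \<le> norm (b x)"
        using elim(3) norm_triangle_ineq2 [of "b xs" "b x"] by (simp add: \<beta>_def dist_norm norm_minus_commute)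
      ultimately have t: "\<bar>t\<bar> * \<beta> \<le> C * norm y"
        by (meson abs_ge_zero mult_left_mono order_trans)
      have "\<bar>(b x - b xs) \<bullet> y\<bar> \<le> e * norm y"
        using elim(3) by (intro order_trans [OF Cauchy_Schwarz_ineq2] mult_right_mono) (auto simp: dist_norm)
      \<comment> \<open>One \<open>e\<close> comes from the expansion of \<open>h\<close> at
        \<open>xs\<close>, the other from replacing \<open>b xs\<close> by
        \<open>b x\<close>.\<close>
      then have bxy: "\<bar>b x \<bullet> y\<bar> \<le> 2 * e * norm y"
        using elim(2) \<open>h x = 0\<close> by (simp add: inner_diff_left flip: y_def)
      have "\<beta> * (m / 2 * (norm y)\<^sup>2) \<le> \<beta> * \<bar>t * (b x \<bullet> y)\<bar>"
        using Gy that \<open>\<beta> > 0\<close> by (intro mult_left_mono) auto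
      also have "\<dots> = (\<bar>t\<bar> * \<beta>) * \<bar>b x \<bullet> y\<bar>" by (simp add: abs_mult)
      also have "\<dots> \<le> (C * norm y) * (2 * e * norm y)"
        by (rule mult_mono [OF t bxy]) (use \<open>C > 0\<close> in auto)
      also have "\<dots> = \<beta> * (m / 4 * (norm y)\<^sup>2)"
        using \<open>C > 0\<close> by (simp add: e_def power2_eq_square)
      finally show False using \<open>\<beta> > 0\<close> m(1) \<open>y \<noteq> 0\<close> by simp
    qed
    moreover have "G x \<bullet> y > 0" if "x \<noteq> xs"
    proof -
      have "0 < m / 2 * (norm y)\<^sup>2" using that m by (simp add: y_def)
      with Gy show ?thesis by linarith
    qed
    ultimately show ?case unfolding y_def by blast
  qed
qed

text \<open>Mean value theorem along the segment from \<open>xs\<close> to \<open>x\<close>: at each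
  of its inner points \<open>G\<close> makes an acute angle with the outward direction.\<close>

lemma strict_minimum_if_radially_increasing:
  fixes W :: "'a::real_inner \<Rightarrow> real"
  assumes der: "\<And>y. y \<in> cball xs r \<Longrightarrow> (W has_derivative (\<lambda>v. G y \<bullet> v)) (at y)"
    and pos: "\<And>y. y \<in> cball xs r \<Longrightarrow> y \<noteq> xs \<Longrightarrow> G y \<bullet> (y - xs) > 0"
    and x: "x \<in> cball xs r" "x \<noteq> xs"
  shows "W xs < W x"
proof -
  define y where "y s = xs + s *\<^sub>R (x - xs)" for s :: real
  have in_ball: "y s \<in> cball xs r" if "0 \<le> s" "s \<le> 1" for s
  proof -
    have "\<bar>s\<bar> * norm (x - xs) \<le> 1 * norm (x - xs)" using that by (intro mult_right_mono) auto
    then show ?thesis using x(1) by (simp add: y_def dist_norm norm_minus_commute)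
  qed
  have "((\<lambda>s. W (y s)) has_real_derivative G (y s) \<bullet> (x - xs)) (at s)" if "0 \<le> s" "s \<le> 1" for s
  proof -
    have "(y has_derivative (\<lambda>d. d *\<^sub>R (x - xs))) (at s)"
      unfolding y_def by (auto intro!: derivative_eq_intros)
    from has_derivative_compose [OF this der [OF in_ball [OF that]]]
    have "((\<lambda>s. W (y s)) has_derivative (\<lambda>d. d * (G (y s) \<bullet> (x - xs)))) (at s)" by simp
    then show ?thesis
      by (rule has_derivative_imp_has_field_derivative) simp
  qed
  then obtain s where s: "0 < s" "s < 1" "W (y 1) - W (y 0) = (1 - 0) * (G (y s) \<bullet> (x - xs))"
    using MVT2 [of 0 1 "\<lambda>s. W (y s)" "\<lambda>s. G (y s) \<bullet> (x - xs)"] by auto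
  have "0 < G (y s) \<bullet> (y s - xs)"
    using s x by (intro pos in_ball) (auto simp: y_def)
  then have "0 < s * (G (y s) \<bullet> (x - xs))" by (simp add: y_def)
  then show ?thesis using s by (simp add: y_def zero_less_mult_iff)
qed

section \<open>Decay along solutions\<close>

lemma has_vector_derivative_le_imp_decrease:
  fixes f f' :: "real \<Rightarrow> real"
  assumes "a \<le> b" "\<And>t. t \<in> {a..b} \<Longrightarrow> (f has_vector_derivative f' t) (at t within {a..b})"
    and "\<And>t. t \<in> {a..b} \<Longrightarrow> f' t \<le> - z"
  shows "f b \<le> f a - z * (b - a)"
proof -
  obtain t where "t \<in> {a..b}" "f b - f a = (b - a) *\<^sub>R f' t"
    using mvt_very_simple [of a b f "\<lambda>t d. d *\<^sub>R f' t"] assms(1,2)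
    by (auto simp: has_vector_derivative_def)
  moreover have "(b - a) * f' t \<le> (b - a) * - z"
    using assms \<open>t \<in> _\<close> by (intro mult_left_mono) auto
  ultimately show ?thesis by (simp add: algebra_simps)
qed

text \<open>The square of a solution is nonincreasing, so a solution that has reached zero stays there.\<close>

lemma scalar_decay_sign_preserved:
  fixes y :: "real \<Rightarrow> real"
  assumes y: "\<And>t. t \<in> {a..b} \<Longrightarrow> (y has_vector_derivative - \<alpha> (y t)) (at t within {a..b})"
    and \<alpha>: "\<And>x. 0 \<le> x * \<alpha> x"
  obtains \<sigma> where "\<sigma> = 1 \<or> \<sigma> = -1" "\<And>t. t \<in> {a..b} \<Longrightarrow> \<sigma> * y t = \<bar>y t\<bar>"
proof -
  define \<sigma> :: real where "\<sigma> = (if 0 \<le> y a then 1 else -1)"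
  have sq: "(y t)\<^sup>2 \<le> (y s)\<^sup>2" if "a \<le> s" "s \<le> t" "t \<le> b" for s t
  proof -
    have "((\<lambda>t. (y t)\<^sup>2) has_vector_derivative - 2 * (y u * \<alpha> (y u))) (at u within {s..t})" if "u \<in> {s..t}" for u
    proof -
      have "(y has_vector_derivative - \<alpha> (y u)) (at u within {s..t})"
        by (rule has_vector_derivative_within_subset [OF y]) (use that \<open>a \<le> s\<close> \<open>t \<le> b\<close> in auto)
      then have "(y has_real_derivative - \<alpha> (y u)) (at u within {s..t})"
        by (simp add: has_real_derivative_iff_has_vector_derivative)
      then have "((\<lambda>t. (y t)\<^sup>2) has_real_derivative - 2 * (y u * \<alpha> (y u))) (at u within {s..t})"
        using DERIV_mult [of y _ u "{s..t}" y] by (fastforce simp: power2_eq_square mult.commute)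
      then show ?thesis by (simp add: has_real_derivative_iff_has_vector_derivative)
    qed
    from has_vector_derivative_le_imp_decrease [OF \<open>s \<le> t\<close> this, of 0]
    show ?thesis using \<alpha> by simp
  qed
  have "\<sigma> * y t \<ge> 0" if t: "t \<in> {a..b}" for t
  proof (rule ccontr)
    assume neg: "\<not> \<sigma> * y t \<ge> 0"
    have "continuous_on {a..b} y"
      using has_vector_derivative_continuous [OF y] by (simp add: continuous_on_eq_continuous_within)
    then have "continuous_on {a..t} y"
      by (rule continuous_on_subset) (use t in auto)
    then have "continuous_on {a..t} (\<lambda>s. - (\<sigma> * y s))"
      by (intro continuous_intros)
    moreover have "- (\<sigma> * y a) \<le> 0" by (simp add: \<sigma>_def)
    ultimately obtain s where s: "a \<le> s" "s \<le> t" "- (\<sigma> * y s) = 0"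
      using IVT' [of "\<lambda>s. - (\<sigma> * y s)" a 0 t] neg t by auto
    moreover have "\<sigma> \<noteq> 0" by (simp add: \<sigma>_def)
    ultimately have "y s = 0" by simp
    then have "y t = 0" using sq [OF s(1,2)] t by simp
    with neg show False by simp
  qed
  moreover have "\<sigma> * x = \<bar>x\<bar>" if "\<sigma> * x \<ge> 0" for x
    using that by (cases "0 \<le> y a") (simp_all add: \<sigma>_def)
  moreover have "\<sigma> = 1 \<or> \<sigma> = -1" by (simp add: \<sigma>_def)
  ultimately show thesis using that by blast
qed

section \<open>The closed loop near a boundary equilibrium\<close>

text \<open>At a critical point of \<open>V\<close> every input yields the value 0, against the
  negative bound. At a boundary equilibrium this excludes both \<open>c = 0\<close> and a vanishing
  gradient of \<open>h\<close>.\<close>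

lemma gradient_nonzero_if_clf:
  assumes "control_lyapunov_function V \<gamma>" "\<gamma> (V x) > 0"
  shows "gradient V x \<noteq> 0"
proof
  assume "gradient V x = 0"
  then have "(INF u. ereal (gradient V x \<bullet> u)) = 0" by (simp add: zero_ereal_def)
  moreover have "(INF u. ereal (gradient V x \<bullet> u)) \<le> ereal (- \<gamma> (V x))"
    using assms by (simp add: control_lyapunov_function_def)
  ultimately show False using assms(2) by (simp add: zero_ereal_def)
qed

lemma has_vector_derivative_along:
  assumes "f differentiable (at (\<phi> t))" "(\<phi> has_vector_derivative v) (at t within S)"
  shows "((\<lambda>t. f (\<phi> t)) has_vector_derivative gradient f (\<phi> t) \<bullet> v) (at t within S)"
  using vector_derivative_diff_chain_within
    [OF assms(2) has_derivative_at_withinI [OF gradient_has_derivative [OF assms(1)]]]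
  by (simp add: o_def)

text \<open>Positive multipliers that make both constraints tight certify the minimiser. The
  tolerance 1 for \<open>l2 / l1\<close> is what the coefficient 2 of \<open>\<bar>h x\<bar>\<close>
  in the Lyapunov function can absorb.\<close>

lemma eventually_clf_cbf_qp_active:
  assumes cont: "isCont (gradient V) xs" "isCont (gradient h) xs" "isCont (\<lambda>x. \<gamma> (V x)) xs" "isCont (\<lambda>x. \<alpha> (h x)) xs"
    and "p > 0" "c > 0" "gradient h xs \<noteq> 0" "gradient V xs = c *\<^sub>R gradient h xs"
    and "\<alpha> (h xs) = 0" "\<gamma> (V xs) > 0"
  shows "\<forall>\<^sub>F x in nhds xs. \<exists>l1 l2. 0 < l1 \<and> l1 < 2 * p * \<gamma> (V xs) \<and> \<bar>l2 / l1 - c\<bar> < 1 \<and>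
    fst (clf_cbf_qp V \<gamma> h \<alpha> p x) = l2 *\<^sub>R gradient h x - l1 *\<^sub>R gradient V x \<and>
    gradient h x \<bullet> fst (clf_cbf_qp V \<gamma> h \<alpha> p x) = - \<alpha> (h x)"
proof -
  have "\<forall>\<^sub>F x in nhds xs. \<exists>l1 l2. 0 < l1 \<and> l1 < 2 * p * \<gamma> (V xs) \<and> 0 < l2 \<and> \<bar>l2 / l1 - c\<bar> < 1 \<and>
     gradient V x \<bullet> (l2 *\<^sub>R gradient h x - l1 *\<^sub>R gradient V x) = - \<gamma> (V x) + l1 / p \<and>
     gradient h x \<bullet> (l2 *\<^sub>R gradient h x - l1 *\<^sub>R gradient V x) = - \<alpha> (h x)"
    using assms by (intro eventually_multipliers) auto
  then show ?thesis
  proof eventually_elim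
    case (elim x)
    then obtain l1 l2 where l: "0 < l1" "l1 < 2 * p * \<gamma> (V xs)" "0 < l2" "\<bar>l2 / l1 - c\<bar> < 1"
      and active: "gradient V x \<bullet> (l2 *\<^sub>R gradient h x - l1 *\<^sub>R gradient V x) = - \<gamma> (V x) + l1 / p"
        "gradient h x \<bullet> (l2 *\<^sub>R gradient h x - l1 *\<^sub>R gradient V x) = - \<alpha> (h x)"
      by blast
    \<comment> \<open>The optimal slack is \<open>l1 / p\<close>, so that the multiplier
      \<open>p * w\<close> of the Lyapunov constraint is \<open>l1\<close>.\<close>
    have "clf_cbf_qp V \<gamma> h \<alpha> p x = (l2 *\<^sub>R gradient h x - l1 *\<^sub>R gradient V x, l1 / p)"
      unfolding clf_cbf_qp_def
      by (rule qp_minimiser_of_multipliers [where \<mu> = l2]) (use l active \<open>p > 0\<close> in auto)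
    with l active show ?case by auto
  qed
qed

text \<open>The Lyapunov argument in isolation: the quadratic program enters only through the
  multiplier form of \<open>k\<close> and the tight barrier constraint. \<open>incr\<close> makes
  \<open>W\<close> grow away from \<open>xs\<close>, and \<open>iso\<close> rules out further zeros
  of the rate \<open>Z\<close>.\<close>

lemma asymptotically_stable_if_both_active:
  fixes V h :: "real^'n \<Rightarrow> real" and k :: "real^'n \<Rightarrow> real^'n" and c \<Lambda> :: real
  defines "G \<equiv> \<lambda>x. gradient V x - c *\<^sub>R gradient h x"
  assumes "r > 0" and sub: "cball xs r \<subseteq> D" and lip: "L-lipschitz_on (cball xs r) k"
    and k_xs: "k xs = 0" and h_xs: "h xs = 0"
    and dV: "\<And>x. x \<in> cball xs r \<Longrightarrow> V differentiable (at x)"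
    and dh: "\<And>x. x \<in> cball xs r \<Longrightarrow> h differentiable (at x)"
    and \<alpha>: "continuous_on UNIV \<alpha>" "strict_mono \<alpha>" "\<alpha> 0 = 0" and \<Lambda>: "\<Lambda> > 0"
    and rep: "\<And>x. x \<in> cball xs r \<Longrightarrow> \<exists>l1 l2. 0 < l1 \<and> l1 < \<Lambda> \<and> \<bar>l2 / l1 - c\<bar> < 1 \<and>
      k x = l2 *\<^sub>R gradient h x - l1 *\<^sub>R gradient V x \<and> gradient h x \<bullet> k x = - \<alpha> (h x)"
    and incr: "\<And>x. x \<in> cball xs r \<Longrightarrow> x \<noteq> xs \<Longrightarrow> G x \<bullet> (x - xs) > 0"
    and iso: "\<And>x t. x \<in> cball xs r \<Longrightarrow> x \<noteq> xs \<Longrightarrow> h x = 0 \<Longrightarrow> G x \<noteq> t *\<^sub>R gradient h x"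
  shows "asymptotically_stable_equilibrium D k xs"
proof -
  have V_cont: "continuous_on (cball xs r) V" and h_cont: "continuous_on (cball xs r) h"
    using dV dh by (auto intro!: differentiable_imp_continuous_on differentiable_at_imp_differentiable_on)
  have k_cont: "continuous_on (cball xs r) k"
    using lip by (rule lipschitz_on_continuous_on)
  have \<alpha>_h_cont: "continuous_on (cball xs r) (\<lambda>x. \<alpha> (h x))"
    by (rule continuous_on_compose2 [OF \<alpha>(1) h_cont]) simp
  have \<alpha>_sgn: "0 \<le> x * \<alpha> x" for x
    using strict_monoD [OF \<alpha>(2), of 0 x] strict_monoD [OF \<alpha>(2), of x 0] \<alpha>(3)
    by (cases x "0::real" rule: linorder_cases) (simp_all add: zero_le_mult_iff)
  have \<alpha>_zero: "x = 0" if "\<alpha> x = 0" for x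
    using that strict_mono_eq [OF \<alpha>(2), of x 0] \<alpha>(3) by simp
  define W where "W x = V x - c * h x" for x
  \<comment> \<open>One of the two copies of \<open>\<bar>h x\<bar>\<close> compensates the term
    without sign in the derivative of \<open>W\<close>; the decay of the other provides the second
    summand of \<open>Z\<close>.\<close>
  define U where "U x = W x - W xs + 2 * \<bar>h x\<bar>" for x
  define Z where "Z x = (norm (k x))\<^sup>2 / \<Lambda> + \<bar>\<alpha> (h x)\<bar>" for x
  have W: "(W has_derivative (\<lambda>v. G x \<bullet> v)) (at x)" if "x \<in> cball xs r" for x
  proof -
    have "(W has_derivative (\<lambda>v. gradient V x \<bullet> v - c * (gradient h x \<bullet> v))) (at x)"
      unfolding W_def by (intro derivative_intros gradient_has_derivative dV dh that)
    then show ?thesis by (simp add: G_def inner_diff_left)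
  qed
  have rate: "G x \<bullet> k x \<le> - (norm (k x))\<^sup>2 / \<Lambda> + \<bar>\<alpha> (h x)\<bar>" "gradient h x \<bullet> k x = - \<alpha> (h x)"
    if x: "x \<in> cball xs r" for x
  proof -
    obtain l1 l2 where l: "0 < l1" "l1 < \<Lambda>" "\<bar>l2 / l1 - c\<bar> < 1"
      and k: "k x = l2 *\<^sub>R gradient h x - l1 *\<^sub>R gradient V x" and hk: "gradient h x \<bullet> k x = - \<alpha> (h x)"
      using rep [OF x] by blast
    \<comment> \<open>Solving the multiplier form for the gradient of \<open>V\<close> exposes
      \<open>k x\<close>. Pairing with \<open>k x\<close> then produces the negative square, and the
      tight barrier constraint evaluates the remaining term.\<close>
    have "G x = (l2 / l1 - c) *\<^sub>R gradient h x - (1 / l1) *\<^sub>R k x"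
      using l(1) by (simp add: G_def k algebra_simps)
    then have "G x \<bullet> k x = (l2 / l1 - c) * (gradient h x \<bullet> k x) - (norm (k x))\<^sup>2 / l1"
      by (simp add: inner_diff_left power2_norm_eq_inner)
    also have "\<dots> \<le> \<bar>\<alpha> (h x)\<bar> - (norm (k x))\<^sup>2 / \<Lambda>"
    proof (rule diff_mono)
      have "(l2 / l1 - c) * (gradient h x \<bullet> k x) \<le> \<bar>l2 / l1 - c\<bar> * \<bar>\<alpha> (h x)\<bar>"
        using abs_ge_self [of "(l2 / l1 - c) * (gradient h x \<bullet> k x)"] by (simp add: abs_mult hk)
      also have "\<dots> \<le> 1 * \<bar>\<alpha> (h x)\<bar>" using l by (intro mult_right_mono) auto
      finally show "(l2 / l1 - c) * (gradient h x \<bullet> k x) \<le> \<bar>\<alpha> (h x)\<bar>" by simp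
      \<comment> \<open>The uniform bound \<open>\<Lambda>\<close> replaces \<open>l1\<close>, which
        is chosen separately for each \<open>x\<close>; this makes \<open>Z\<close>
        continuous.\<close>
      show "(norm (k x))\<^sup>2 / \<Lambda> \<le> (norm (k x))\<^sup>2 / l1" using l by (intro divide_left_mono) auto
    qed
    finally show "G x \<bullet> k x \<le> - (norm (k x))\<^sup>2 / \<Lambda> + \<bar>\<alpha> (h x)\<bar>" by simp
    show "gradient h x \<bullet> k x = - \<alpha> (h x)" by (rule hk)
  qed
  show ?thesis
  proof (rule asymptotically_stable_if_lyapunov [of r xs D k L U Z])
    show "continuous_on (cball xs r) U" "continuous_on (cball xs r) Z"
      unfolding U_def W_def Z_def
      using \<Lambda> h_cont k_cont \<alpha>_h_cont V_cont by (auto intro!: continuous_intros)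
    show "U xs = 0" by (simp add: U_def h_xs)
    show "0 < U x" if "x \<in> cball xs r" "x \<noteq> xs" for x
      using strict_minimum_if_radially_increasing [OF W incr that] by (simp add: U_def)
    show "0 \<le> Z x" for x using \<Lambda> by (simp add: Z_def)
    \<comment> \<open>A zero of \<open>Z\<close> is a zero of \<open>k\<close> on the boundary.
      There the two gradients are parallel, so \<open>G x\<close> is a multiple of the gradient of
      \<open>h\<close>.\<close>
    show "Z x \<noteq> 0" if x: "x \<in> cball xs r" "x \<noteq> xs" for x
    proof
      assume "Z x = 0"
      moreover have "(norm (k x))\<^sup>2 / \<Lambda> \<ge> 0" using \<Lambda> by simp
      ultimately have "(norm (k x))\<^sup>2 / \<Lambda> = 0" "\<bar>\<alpha> (h x)\<bar> = 0" unfolding Z_def by linarith+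
      then have "k x = 0" "h x = 0" using \<Lambda> \<alpha>_zero by auto
      obtain l1 l2 where l: "0 < l1" "k x = l2 *\<^sub>R gradient h x - l1 *\<^sub>R gradient V x"
        using rep [OF x(1)] by blast
      from l(1) have "gradient V x = (1 / l1) *\<^sub>R (l1 *\<^sub>R gradient V x)" by simp
      also have "l1 *\<^sub>R gradient V x = l2 *\<^sub>R gradient h x" using l(2) \<open>k x = 0\<close> by simp
      finally have "G x = (l2 / l1 - c) *\<^sub>R gradient h x"
        by (simp add: G_def algebra_simps)
      with iso [OF x \<open>h x = 0\<close>] show False by blast
    qed
    fix \<phi> :: "real \<Rightarrow> real^'n" and a b z :: real
    assume "a \<le> b" and "\<And>t. t \<in> {a..b} \<Longrightarrow> \<phi> t \<in> cball xs r \<and> z \<le> Z (\<phi> t) \<and>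
      (\<phi> has_vector_derivative k (\<phi> t)) (at t within {a..b})"
    then have \<phi>: "\<phi> t \<in> cball xs r" "z \<le> Z (\<phi> t)" "(\<phi> has_vector_derivative k (\<phi> t)) (at t within {a..b})"
      if "t \<in> {a..b}" for t using that by auto
    have h\<phi>: "((\<lambda>t. h (\<phi> t)) has_vector_derivative - \<alpha> (h (\<phi> t))) (at t within {a..b})" if "t \<in> {a..b}" for t
      using has_vector_derivative_along [OF dh [OF \<phi>(1) [OF that]] \<phi>(3) [OF that]]
      by (simp add: rate(2) [OF \<phi>(1) [OF that]])
    \<comment> \<open>Since \<open>h\<close> keeps its sign along the solution,
      \<open>\<bar>h x\<bar>\<close> may be replaced there by the differentiable
      \<open>\<sigma> * h x\<close>.\<close>
    obtain \<sigma> where \<sigma>: "\<sigma> = 1 \<or> \<sigma> = -1" "\<And>t. t \<in> {a..b} \<Longrightarrow> \<sigma> * h (\<phi> t) = \<bar>h (\<phi> t)\<bar>"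
      using scalar_decay_sign_preserved [of a b "\<lambda>t. h (\<phi> t)" \<alpha>] h\<phi> \<alpha>_sgn by blast
    have "(\<lambda>t. W (\<phi> t) + 2 * \<sigma> * h (\<phi> t)) b \<le> (\<lambda>t. W (\<phi> t) + 2 * \<sigma> * h (\<phi> t)) a - z * (b - a)"
    proof (rule has_vector_derivative_le_imp_decrease [OF \<open>a \<le> b\<close>])
      fix t assume t: "t \<in> {a..b}"
      have "((\<lambda>t. W (\<phi> t)) has_vector_derivative G (\<phi> t) \<bullet> k (\<phi> t)) (at t within {a..b})"
        using vector_derivative_diff_chain_within
          [OF \<phi>(3) [OF t] has_derivative_at_withinI [OF W [OF \<phi>(1) [OF t]]]]
        by (simp add: o_def)
      then show "((\<lambda>t. W (\<phi> t) + 2 * \<sigma> * h (\<phi> t)) has_vector_derivative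
          G (\<phi> t) \<bullet> k (\<phi> t) + 2 * \<sigma> * - \<alpha> (h (\<phi> t))) (at t within {a..b})"
        by (intro has_vector_derivative_add has_vector_derivative_mult_right h\<phi> t)
      have "\<sigma> * \<alpha> (h (\<phi> t)) = \<bar>\<alpha> (h (\<phi> t))\<bar>"
        using \<sigma>(1) \<sigma>(2) [OF t] \<alpha>_sgn [of "h (\<phi> t)"] \<alpha>(3)
        by (cases "h (\<phi> t) = 0") (auto simp: zero_le_mult_iff)
      then show "G (\<phi> t) \<bullet> k (\<phi> t) + 2 * \<sigma> * - \<alpha> (h (\<phi> t)) \<le> - z"
        using rate(1) [OF \<phi>(1) [OF t]] \<phi>(2) [OF t] by (simp add: Z_def)
    qed
    then show "U (\<phi> b) \<le> U (\<phi> a) - z * (b - a)"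
      using \<sigma>(2) [of a] \<sigma>(2) [of b] \<open>a \<le> b\<close> by (simp add: U_def mult.assoc)
  qed (use \<open>r > 0\<close> sub k_xs lip in auto)
qed

theorem theorem2:
  fixes V h :: "real^'n \<Rightarrow> real" and D :: "(real^'n) set"
    and \<gamma> \<alpha> :: "real \<Rightarrow> real" and p c :: real
    and k :: "real^'n \<Rightarrow> real^'n" and \<delta> :: "real^'n \<Rightarrow> real"
    and xs :: "real^'n"
  assumes clf: "control_lyapunov_function V \<gamma>"
    and conv: "convex_on UNIV V"
    and cbf: "control_barrier_function D h \<alpha>"
    and V_smooth: "twice_differentiable_on V UNIV"
    and h_smooth: "twice_differentiable_on h D"
    and p_pos: "p > 0"
    and qp: "\<And>x. x \<in> D \<Longrightarrow> (k x, \<delta> x) = clf_cbf_qp V \<gamma> h \<alpha> p x"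
    and k_lipschitz: "locally_lipschitz_on k D"
    and eq: "xs \<in> boundary_equilibria D V \<gamma> h \<alpha> p"
    and c_nonneg: "c \<ge> 0"
    and c_eq: "gradient V xs = c *\<^sub>R gradient h xs"
    and pos_def: "pos_def_matrix (hessian V xs - c *\<^sub>R hessian h xs)"
  shows "asymptotically_stable_equilibrium D k xs"
proof -
  have xs: "xs \<in> D" "h xs = 0" "\<gamma> (V xs) \<noteq> 0"
    using eq by (auto simp: boundary_equilibria_def both_active_def)
  have D: "open D" and \<alpha>: "strict_mono \<alpha>" "\<alpha> 0 = 0" "locally_lipschitz_on \<alpha> UNIV"
    using cbf by (auto simp: control_barrier_function_def extended_class_K_inf_def)
  have dV: "V differentiable (at x)" "gradient V differentiable (at x)" for x
    using V_smooth by (auto simp: twice_differentiable_on_def)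
  have dh: "h differentiable (at x)" "gradient h differentiable (at x)" if "x \<in> D" for x
    using h_smooth that by (auto simp: twice_differentiable_on_def)
  have V_nonneg: "V x \<ge> 0" for x
    using clf unfolding control_lyapunov_function_def positive_definite_fun_def
    by (cases "x = 0") (simp_all add: less_imp_le)
  have \<gamma>: "continuous_on {0..} \<gamma>" "strict_mono_on {0..} \<gamma>" "\<gamma> 0 = 0"
    using clf by (auto simp: control_lyapunov_function_def class_K_def)
  have \<gamma>_pos: "\<gamma> (V xs) > 0"
  proof -
    have "0 < V xs" using V_nonneg [of xs] xs(3) \<gamma>(3) by (auto simp: le_less)
    then show ?thesis using strict_mono_onD [OF \<gamma>(2), of 0 "V xs"] \<gamma>(3) by simp
  qed
  have V_cont: "continuous_on S V" for S
    using dV(1) by (intro differentiable_imp_continuous_on differentiable_at_imp_differentiable_on)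
  have h_cont: "continuous_on D h"
    using dh(1) by (intro differentiable_imp_continuous_on differentiable_at_imp_differentiable_on)
  have \<alpha>_cont: "continuous_on UNIV \<alpha>"
    using local_lipschitz_continuous_on [OF \<alpha>(3)] by simp
  have \<alpha>_h_cont: "continuous_on D (\<lambda>x. \<alpha> (h x))"
    by (rule continuous_on_compose2 [OF \<alpha>_cont h_cont]) simp
  have grad_nz: "gradient V xs \<noteq> 0" by (rule gradient_nonzero_if_clf [OF clf \<gamma>_pos])
  then have c: "c > 0" and b_nz: "gradient h xs \<noteq> 0" using c_eq c_nonneg by (auto simp: le_less)

  define \<Lambda> where "\<Lambda> = 2 * p * \<gamma> (V xs)"
  have \<Lambda>: "\<Lambda> > 0" using p_pos \<gamma>_pos by (simp add: \<Lambda>_def)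
  define G where "G x = gradient V x - c *\<^sub>R gradient h x" for x
  define rep where "rep x \<longleftrightarrow> (\<exists>l1 l2. 0 < l1 \<and> l1 < \<Lambda> \<and> \<bar>l2 / l1 - c\<bar> < 1 \<and>
    k x = l2 *\<^sub>R gradient h x - l1 *\<^sub>R gradient V x \<and> gradient h x \<bullet> k x = - \<alpha> (h x))" for x
  have ev_D: "\<forall>\<^sub>F x in nhds xs. x \<in> D" by (rule eventually_nhds_in_open [OF D xs(1)])
  have ev_rep: "\<forall>\<^sub>F x in nhds xs. rep x"
  proof -
    have "isCont (gradient V) xs" "isCont (gradient h) xs"
      using dV(2) dh(2) xs by (auto intro: differentiable_imp_continuous_within)
    moreover have "isCont (\<lambda>x. \<gamma> (V x)) xs"
    proof -
      have "continuous_on UNIV (\<lambda>x. \<gamma> (V x))"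
        by (rule continuous_on_compose2 [OF \<gamma>(1) V_cont]) (use V_nonneg in auto)
      then show ?thesis by (simp add: continuous_on_eq_continuous_at)
    qed
    moreover have "isCont (\<lambda>x. \<alpha> (h x)) xs"
      using \<alpha>_h_cont D xs by (simp add: continuous_on_eq_continuous_at)
    ultimately have "\<forall>\<^sub>F x in nhds xs. \<exists>l1 l2. 0 < l1 \<and> l1 < \<Lambda> \<and> \<bar>l2 / l1 - c\<bar> < 1 \<and>
        fst (clf_cbf_qp V \<gamma> h \<alpha> p x) = l2 *\<^sub>R gradient h x - l1 *\<^sub>R gradient V x \<and>
        gradient h x \<bullet> fst (clf_cbf_qp V \<gamma> h \<alpha> p x) = - \<alpha> (h x)"
      unfolding \<Lambda>_def using p_pos c b_nz c_eq xs \<gamma>_pos \<alpha> by (intro eventually_clf_cbf_qp_active) auto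
    with ev_D show ?thesis
    proof eventually_elim
      case (elim x)
      have "fst (clf_cbf_qp V \<gamma> h \<alpha> p x) = k x" using qp [OF \<open>x \<in> D\<close>] by (metis fst_conv)
      with elim(2) show ?case unfolding rep_def by simp
    qed
  qed
  \<comment> \<open>\<open>k xs\<close> is a multiple of the gradient of \<open>h\<close>, both
    gradients being parallel, and also orthogonal to it because
    \<open>\<alpha> (h xs) = 0\<close>.\<close>
  have k_xs: "k xs = 0"
  proof -
    obtain l1 l2 where k: "k xs = l2 *\<^sub>R gradient h xs - l1 *\<^sub>R gradient V xs"
      and orth: "gradient h xs \<bullet> k xs = - \<alpha> (h xs)"
      using eventually_nhds_x_imp_x [OF ev_rep] unfolding rep_def by blast
    have "k xs = (l2 - l1 * c) *\<^sub>R gradient h xs"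
      unfolding k by (simp add: c_eq algebra_simps)
    moreover from this have "(l2 - l1 * c) * (gradient h xs \<bullet> gradient h xs) = 0"
      using orth xs(2) \<alpha>(2) by simp
    ultimately show ?thesis using b_nz by auto
  qed
  have G: "(G has_derivative (\<lambda>v. (hessian V xs - c *\<^sub>R hessian h xs) *v v)) (at xs)"
  proof -
    have "(G has_derivative (\<lambda>v. hessian V xs *v v - c *\<^sub>R (hessian h xs *v v))) (at xs)"
      unfolding G_def by (intro derivative_intros hessian_has_derivative dV dh xs)
    then show ?thesis by (simp add: matrix_vector_mult_diff_rdistrib scaleR_matrix_vector_assoc)
  qed
  have ev_iso: "\<forall>\<^sub>F x in nhds xs. x \<noteq> xs \<longrightarrow>
      G x \<bullet> (x - xs) > 0 \<and> (h x = 0 \<longrightarrow> (\<forall>t. G x \<noteq> t *\<^sub>R gradient h x))"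
    using dh xs
    by (intro eventually_isolated_critical_point [OF G _ pos_def] gradient_has_derivative b_nz
        differentiable_imp_continuous_within) (auto simp: G_def c_eq)
  obtain r1 where r1: "r1 > 0" "\<And>x. dist x xs < r1 \<Longrightarrow> x \<in> D \<and> rep x \<and> (x \<noteq> xs \<longrightarrow>
      G x \<bullet> (x - xs) > 0 \<and> (h x = 0 \<longrightarrow> (\<forall>t. G x \<noteq> t *\<^sub>R gradient h x)))"
    using eventually_conj [OF ev_D eventually_conj [OF ev_rep ev_iso]]
    unfolding eventually_nhds_metric by blast
  obtain r2 L where r2: "r2 > 0" "L-lipschitz_on (cball xs r2 \<inter> D) k"
  \<comment> \<open>The dummy time is set to 0.\<close>
  proof (rule local_lipschitzE [OF k_lipschitz, of 0 xs])
    fix u L assume "0 < u" and L: "\<And>s :: real. s \<in> cball 0 u \<inter> UNIV \<Longrightarrow> L-lipschitz_on (cball xs u \<inter> D) k"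
    then show thesis using that [of u L] \<open>0 < u\<close> L [of 0] by simp
  qed (use xs in auto)
  \<comment> \<open>Half of \<open>r1\<close>, because the closed ball has to fit into the open ball
    of radius \<open>r1\<close>.\<close>
  define r where "r = min (r1 / 2) r2"
  have "r > 0" using r1 r2 by (simp add: r_def)
  have in_ball: "x \<in> D" "rep x" "x \<noteq> xs \<Longrightarrow> G x \<bullet> (x - xs) > 0"
    "x \<noteq> xs \<Longrightarrow> h x = 0 \<Longrightarrow> G x \<noteq> t *\<^sub>R gradient h x" if "x \<in> cball xs r" for x t
    using r1(2) [of x] that r1(1) by (auto simp: r_def dist_commute)
  have sub: "cball xs r \<subseteq> D" using in_ball by blast
  have lip: "L-lipschitz_on (cball xs r) k"
    by (rule lipschitz_on_subset [OF r2(2)]) (use sub in \<open>auto simp: r_def\<close>)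

  show ?thesis
  proof (rule asymptotically_stable_if_both_active [of r xs D L k h V \<alpha> \<Lambda> c])
    show "\<exists>l1 l2. 0 < l1 \<and> l1 < \<Lambda> \<and> \<bar>l2 / l1 - c\<bar> < 1 \<and>
      k x = l2 *\<^sub>R gradient h x - l1 *\<^sub>R gradient V x \<and> gradient h x \<bullet> k x = - \<alpha> (h x)"
      if "x \<in> cball xs r" for x
      using in_ball(2) [OF that] unfolding rep_def .
  qed (use \<open>r > 0\<close> sub lip k_xs xs dV dh in_ball \<alpha> \<alpha>_cont \<Lambda> in \<open>auto simp: G_def\<close>)
qed

end
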